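(* Let $H$ be a finite-dimensional Hilbert space, let $(f_i)_{i=1}^n$ be any finite sequence of vectors in $H$, and let $G_0=(f_i)_{i=1}^n$ and $G_{m+1}=\Phi(G_m)$ for $m\ge 0$, where $\Phi$ is the map given by the generalized Gram--Schmidt procedure. Then the sequence $(G_m)_{m\ge 0}$ has a subsequence that converges in the $\ell^2$-norm on $H^n$, and its limit $(g_i)_{i=1}^n$ is a zero extended orthonormal basis for $\operatorname{span}\{f_i\}_{i=1}^n$. Moreover, for each $k\in\{1,\dots,n\}$, $g_k=0$ if and only if $f_k\in\operatorname{span}\{f_i\}_{i=1}^{k-1}$.
   Context: Inner products $\langle\cdot,\cdot\rangle$ are linear in the first argument. The span of the empty set is $\{0\}$. Generalized Gram--Schmidt procedure (GGSP). Given a finite sequence $(f_i)_{i=1}^n$ in $H$, the procedure produces a sequence $\Phi\left((f_i)_{i=1}^n\right)=(g_i)_{i=1}^n$ in $H$ as follows. For $k=1,2,\dots,n$ in order (the $k$-th step), using the current values of $g_1,\dots,g_{k-1}$: (a) if $f_k=0$, set $g_k:=0$; (b) if $f_k\ne 0$, compute $h:=f_k-\sum_{j=1}^{k-1}\langle f_k,g_j\rangle g_j$. If $h\neq 0$, set $g_k:=h/\|h\|$ and leave $g_1,\dots,g_{k-1}$ unchanged. If $h=0$, then replace, for every $i=1,\dots,k-1$, $g_i$ by $$g_i+\frac{1}{\|f_k\|^2}\left(\frac{1}{\sqrt{1+\|f_k\|^2}}-1\right)\langle g_i,f_k\rangle f_k,$$ and set $g_k:=\frac{1}{\sqrt{1+\|f_k\|^2}}f_k$.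 The output is the sequence $(g_i)_{i=1}^n$ of values after step $n$. The $\ell^2$-norm on $H^n$ is $\|(h_i)_{i=1}^n\|_2=\left(\sum_{i=1}^n\|h_i\|^2\right)^{1/2}$. A finite sequence of vectors is a zero extended orthonormal basis for a subspace $V$ if, after removing all zero vectors from it, the remaining sequence is an orthonormal basis of $V$. *)

theory Defs
  imports
    "HOL-Analysis.Analysis"
    "HOL-Library.Nonpos_Ints"
    "Jordan_Normal_Form.Conjugate"
begin

subsection \<open>The scalar field: real or complex numbers\<close>

text \<open>
  One class covers real and complex Hilbert spaces at once. The lemma
  \<open>real_or_complex_cases\<close> shows that the class has no other members: an instance is either
  the reals, or the complex numbers with their usual conjugation. In both cases the axiom below
  forces the norm to be the usual absolute value.
\<close>

class real_or_complex = conjugatable_field + real_normed_field +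
  assumes mult_conjugate_eq_scaleR: "x * conjugate x = (norm x)\<^sup>2 *\<^sub>R 1"

lemma mult_conjugate_eq_norm:
  "x * conjugate x = (of_real ((norm x)\<^sup>2) :: 'k::real_or_complex)"
  by (simp add: mult_conjugate_eq_scaleR of_real_def)

instance real :: real_or_complex
  by intro_classes (simp add: power2_eq_square)

instance complex :: real_or_complex
  by intro_classes (simp add: scaleR_conv_of_real complex_norm_square flip: of_real_power)

lemma conjugate_eq_imp_Reals:
  fixes u :: "'k::real_or_complex"
  assumes "conjugate u = u"
  shows "u \<in> \<real>"
proof -
  have "u * u = of_real (norm u) * of_real (norm u)"
    using mult_conjugate_eq_norm[of u] assms by (simp add: power2_eq_square)
  then have "u = of_real (norm u) \<or> u = - of_real (norm u)"
    by (simp add: square_eq_iff)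
  then show ?thesis
    by (metis Reals_minus Reals_of_real)
qed

lemma conjugate_of_real:
  "conjugate (of_real r :: 'k::real_or_complex) = of_real r"
proof (cases "r = 0")
  case False
  have "(of_real r :: 'k) * conjugate (of_real r) = of_real r * of_real r"
    using mult_conjugate_eq_norm[of "of_real r :: 'k"] by (simp add: power2_eq_square)
  with False show ?thesis by simp
qed simp

lemma real_or_complex_cases:
  "(\<forall>x::'k::real_or_complex. x \<in> \<real>) \<or>
   (\<exists>j::'k. j * j = -1 \<and> conjugate j = - j \<and>
      (\<forall>x. \<exists>a b. x = of_real a + of_real b * j))"
proof (cases "\<forall>x::'k. x \<in> \<real>")
  case False
  then obtain x :: 'k where x: "x \<notin> \<real>" by blast
  define y where "y = x - conjugate x"
  have cj: "conjugate (z - conjugate z) = - (z - conjugate z)" for z :: 'k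
    by (metis conjugate_dist_add conjugate_id conjugate_neg diff_conv_add_uminus
        minus_diff_eq)
  have "conjugate x \<noteq> x" using x conjugate_eq_imp_Reals by blast
  then have y0: "y \<noteq> 0" by (simp add: y_def)
  define i where "i = of_real (1 / norm y) * y"
  have ci: "conjugate i = - i"
    unfolding i_def conjugate_dist_mul conjugate_of_real
    using cj[of x, folded y_def] by (simp only: mult_minus_right)
  have "norm i = 1" using y0 by (simp add: i_def norm_mult norm_divide)
  then have "i * conjugate i = 1" by (simp add: mult_conjugate_eq_norm)
  then have ii: "i * i = -1" using ci by (metis add.inverse_inverse mult_minus_right)
  have "\<exists>a b. z = of_real a + of_real b * i" for z :: 'k
  proof -
    have "conjugate (z + conjugate z) = z + conjugate z"
      by (simp add: conjugate_dist_add add.commute)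
    then obtain a where a: "z + conjugate z = of_real a"
      by (metis Reals_cases conjugate_eq_imp_Reals)
    have "conjugate ((z - conjugate z) * i) = (z - conjugate z) * i"
      by (simp only: conjugate_dist_mul cj ci minus_mult_minus)
    then obtain b where b: "(z - conjugate z) * i = of_real b"
      by (metis Reals_cases conjugate_eq_imp_Reals)
    have "z - conjugate z = - ((z - conjugate z) * i) * i"
      using ii by (simp add: mult.assoc)
    then have "z - conjugate z = - (of_real b * i)" by (simp only: b) simp
    moreover have "2 * z = (z + conjugate z) + (z - conjugate z)" by simp
    ultimately have "2 * z = of_real a - of_real b * i" by (simp only: a) simp
    then have "z = of_real (a / 2) + of_real (- b / 2) * i"
      by (simp add: field_simps)
    then show ?thesis by blast
  qed
  with ii ci show ?thesis by blast
qed simp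


subsection \<open>Hilbert spaces\<close>

text \<open>The underlying set of the space is the whole type \<open>'a\<close>.\<close>

locale inner_product_space = vector_space scale
  for scale :: "'k::real_or_complex \<Rightarrow> 'a::ab_group_add \<Rightarrow> 'a" (infixr \<open>*s\<close> 75) +
  fixes ip :: "'a \<Rightarrow> 'a \<Rightarrow> 'k"
  assumes ip_add_left: "ip (x + y) z = ip x z + ip y z"
    and ip_scale_left: "ip (c *s x) z = c * ip x z"
    and ip_conjugate: "ip y x = conjugate (ip x y)"
    and ip_nonneg: "ip x x \<in> \<real>\<^sub>\<ge>\<^sub>0"
    and ip_eq_zeroD: "ip x x = 0 \<Longrightarrow> x = 0"
begin

text \<open>\<open>ip x x\<close> is a non-negative real, so the inner \<open>norm\<close> only turns it into an element of type
  \<open>real\<close>.\<close>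

definition vnorm :: "'a \<Rightarrow> real" where
  "vnorm x = sqrt (norm (ip x x))"

text \<open>The space \<open>H\<^sup>n\<close> is represented by the lists of length \<open>n\<close>.\<close>

definition l2norm :: "'a list \<Rightarrow> real" where
  "l2norm hs = sqrt (\<Sum>h\<leftarrow>hs. (vnorm h)\<^sup>2)"

definition l2_converges :: "(nat \<Rightarrow> 'a list) \<Rightarrow> 'a list \<Rightarrow> bool" where
  "l2_converges X gs \<longleftrightarrow>
     (\<forall>m. length (X m) = length gs) \<and>
     (\<lambda>m. l2norm (map2 (-) (X m) gs)) \<longlonglongrightarrow> 0"

definition orthonormal_basis :: "'a list \<Rightarrow> 'a set \<Rightarrow> bool" where
  "orthonormal_basis es V \<longleftrightarrow>
     (\<forall>i < length es. \<forall>j < length es. ip (es ! i) (es ! j) = (if i = j then 1 else 0)) \<and>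
     span (set es) = V"

definition zero_extended_orthonormal_basis :: "'a list \<Rightarrow> 'a set \<Rightarrow> bool" where
  "zero_extended_orthonormal_basis gs V \<longleftrightarrow> orthonormal_basis (filter (\<lambda>g. g \<noteq> 0) gs) V"

text \<open>One step of the generalized Gram--Schmidt procedure: \<open>gs\<close> is the list of the current values
  of $g_1, \dots, g_{k-1}$ and \<open>f\<close> is $f_k$.\<close>

definition ggsp_step :: "'a list \<Rightarrow> 'a \<Rightarrow> 'a list" where
  "ggsp_step gs f =
     (if f = 0 then gs @ [0]
      else let h = f - (\<Sum>g\<leftarrow>gs. ip f g *s g) in
        if h \<noteq> 0 then gs @ [of_real (1 / vnorm h) *s h]
        else
          map (\<lambda>g. g + (of_real (1 / (vnorm f)\<^sup>2 * (1 / sqrt (1 + (vnorm f)\<^sup>2) - 1)) * ip g f) *s f) gs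
          @ [of_real (1 / sqrt (1 + (vnorm f)\<^sup>2)) *s f])"

definition ggsp :: "'a list \<Rightarrow> 'a list" where
  "ggsp fs = foldl ggsp_step [] fs"

end

locale hilbert_space = inner_product_space scale ip
  for scale :: "'k::real_or_complex \<Rightarrow> 'a::ab_group_add \<Rightarrow> 'a" (infixr \<open>*s\<close> 75)
    and ip :: "'a \<Rightarrow> 'a \<Rightarrow> 'k" +
  assumes complete:
    "(\<forall>e>0. \<exists>N. \<forall>m\<ge>N. \<forall>n\<ge>N. vnorm (X m - X n) < e)
       \<Longrightarrow> \<exists>L. (\<lambda>n. vnorm (X n - L)) \<longlonglongrightarrow> 0"

locale finite_dimensional_hilbert_space = hilbert_space +
  assumes finite_dimensional: "\<exists>B. finite B \<and> span B = UNIV"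

end

theory Submission
  imports Defs
begin

text \<open>
  The output of the procedure is always a Parseval frame of the span \<open>V\<close> of its input: when
  $h = 0$ the self-adjoint operator \<open>T\<close> with $T^2 x = x - \langle x, f_k\rangle f_k / (1 + \|f_k\|^2)$ is
  applied to the earlier vectors, which makes room for the new vector. Since \<open>T\<close> is linear, an index
  \<open>k\<close> with $f_k \in \mathrm{span}\{f_i\}_{i<k}$ keeps this property under iteration, and since
  \<open>T\<close> is a contraction, $w = \|g_k\|^2$ becomes at most $w / (1 + w)$ in every round, so it tends
  to \<open>0\<close>. By compactness some subsequence converges. Its limit is again a Parseval frame of \<open>V\<close>, with
  at most \<open>dim V\<close> nonzero vectors, and such a frame is an orthonormal basis.
\<close>


subsection \<open>Bounded sequences of scalars\<close>

lemma norm_conjugate: "norm (conjugate x) = norm (x :: 'k::real_or_complex)"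
proof (cases "x = 0")
  case False
  have "norm x * norm (conjugate x) = norm x * norm x"
    by (metis (no_types) mult_conjugate_eq_norm norm_mult norm_of_real abs_power2 abs_norm_cancel
        power2_eq_square abs_mult)
  with False show ?thesis by simp
qed simp

lemma conjugate_tendsto:
  fixes X :: "nat \<Rightarrow> 'k::real_or_complex"
  assumes "X \<longlonglongrightarrow> c"
  shows "(\<lambda>m. conjugate (X m)) \<longlonglongrightarrow> conjugate c"
proof -
  have "norm (conjugate (X m) - conjugate c) = norm (X m - c)" for m
    by (metis norm_conjugate conjugate_dist_add conjugate_neg diff_conv_add_uminus)
  then show ?thesis
    using assms by (simp add: tendsto_iff dist_norm)
qed

text \<open>Real coordinates bounded by the norm let compactness in the real plane carry over to the
  abstract scalars. Over the reals \<open>j = 0\<close> serves; otherwise expanding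
  \<open>x * conjugate x\<close> with \<open>j * j = -1\<close> yields
  \<open>(norm x)\<^sup>2 = a\<^sup>2 + b\<^sup>2\<close>.\<close>

lemma real_or_complex_coordinates:
  "\<exists>j::'k::real_or_complex. \<forall>x. \<exists>a b. \<bar>a\<bar> \<le> norm x \<and> \<bar>b\<bar> \<le> norm x \<and> x = of_real a + of_real b * j"
  using real_or_complex_cases[where ?'k = 'k]
proof
  assume "\<forall>x::'k. x \<in> \<real>"
  then have "\<exists>a b. \<bar>a\<bar> \<le> norm x \<and> \<bar>b\<bar> \<le> norm x \<and> x = of_real a + of_real b * 0" for x :: 'k
    by (metis Reals_cases abs_ge_zero add.right_neutral mult_zero_right norm_ge_zero norm_of_real
        order_refl abs_zero)
  then show ?thesis by blast
next
  assume "\<exists>j::'k. j * j = -1 \<and> conjugate j = - j \<and> (\<forall>x. \<exists>a b. x = of_real a + of_real b * j)"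
  then obtain j :: 'k where jj: "j * j = -1" and cj: "conjugate j = - j"
    and rep: "\<And>x. \<exists>a b. x = of_real a + of_real b * j" by blast
  have "\<exists>a b. \<bar>a\<bar> \<le> norm x \<and> \<bar>b\<bar> \<le> norm x \<and> x = of_real a + of_real b * j" for x
  proof -
    obtain a b where x: "x = of_real a + of_real b * j" using rep by blast
    have c: "conjugate x = of_real a - of_real b * j"
      by (simp add: x conjugate_dist_add conjugate_dist_mul conjugate_of_real cj)
    have "x * conjugate x = of_real a * of_real a - of_real b * of_real b * (j * j)"
      unfolding c by (simp add: x algebra_simps)
    also have "\<dots> = of_real (a\<^sup>2 + b\<^sup>2)" by (simp add: jj power2_eq_square)
    finally have "(norm x)\<^sup>2 = a\<^sup>2 + b\<^sup>2"
      by (simp add: mult_conjugate_eq_norm del: of_real_power of_real_add)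
    then have "\<bar>a\<bar> \<le> norm x" "\<bar>b\<bar> \<le> norm x"
      by (simp_all add: abs_le_square_iff[of _ "norm x", simplified])
    then show ?thesis using x by blast
  qed
  then show ?thesis by blast
qed

lemma real_or_complex_convergent_subsequence:
  fixes X :: "nat \<Rightarrow> 'k::real_or_complex"
  assumes "\<And>m. norm (X m) \<le> B"
  shows "\<exists>r c. strict_mono (r::nat \<Rightarrow> nat) \<and> (X \<circ> r) \<longlonglongrightarrow> c"
proof -
  obtain j :: 'k where
    "\<forall>x. \<exists>a b. \<bar>a\<bar> \<le> norm x \<and> \<bar>b\<bar> \<le> norm x \<and> x = of_real a + of_real b * j"
    using real_or_complex_coordinates by blast
  then obtain a b where ab: "\<And>x. \<bar>a x\<bar> \<le> norm x \<and> \<bar>b x\<bar> \<le> norm x \<and> x = of_real (a x) + of_real (b x) * j"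
    by metis
  have "norm (a (X m), b (X m)) \<le> B + B" for m
    using ab[of "X m"] assms[of m] norm_Pair_le[of "a (X m)" "b (X m)"] by simp
  then have "bounded (range (\<lambda>m. (a (X m), b (X m))))" by (auto simp: bounded_iff)
  then obtain l r where r: "strict_mono (r::nat \<Rightarrow> nat)"
    and l: "((\<lambda>m. (a (X m), b (X m))) \<circ> r) \<longlonglongrightarrow> l"
    using bounded_imp_convergent_subsequence by blast
  have "(\<lambda>m. of_real (a (X (r m))) + of_real (b (X (r m))) * j) \<longlonglongrightarrow> of_real (fst l) + of_real (snd l) * j"
    using tendsto_fst[OF l] tendsto_snd[OF l] by (intro tendsto_intros) (simp_all add: o_def)
  then have "(X \<circ> r) \<longlonglongrightarrow> of_real (fst l) + of_real (snd l) * j"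
    using ab by (simp add: o_def)
  with r show ?thesis by blast
qed

text \<open>Subsequences are extracted successively, one index at a time; thinning further keeps the
  limits already found.\<close>

lemma real_or_complex_convergent_subsequence_finite:
  fixes X :: "'i \<Rightarrow> nat \<Rightarrow> 'k::real_or_complex"
  assumes "finite I" and "\<And>i m. i \<in> I \<Longrightarrow> norm (X i m) \<le> B"
  shows "\<exists>r c. strict_mono (r::nat \<Rightarrow> nat) \<and> (\<forall>i\<in>I. (X i \<circ> r) \<longlonglongrightarrow> c i)"
  using assms
proof (induction I)
  case empty
  show ?case using strict_mono_id by blast
next
  case (insert i I)
  then obtain r c where r: "strict_mono (r::nat \<Rightarrow> nat)" and c: "\<forall>i\<in>I. (X i \<circ> r) \<longlonglongrightarrow> c i"
    by (metis insert_iff)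
  obtain s d where s: "strict_mono (s::nat \<Rightarrow> nat)" and d: "((X i \<circ> r) \<circ> s) \<longlonglongrightarrow> d"
    using real_or_complex_convergent_subsequence[of "X i \<circ> r" B] insert.prems by auto
  have "(X k \<circ> (r \<circ> s)) \<longlonglongrightarrow> (c(i := d)) k" if "k \<in> insert i I" for k
  proof (cases "k = i")
    case False
    then show ?thesis using that c LIMSEQ_subseq_LIMSEQ[OF _ s, of "X k \<circ> r"] by (simp add: o_assoc)
  qed (use d in \<open>simp add: o_assoc\<close>)
  then show ?case using strict_mono_o[OF r s] by blast
qed

text \<open>For positive terms the hypothesis says that \<open>1 / w\<close> grows by at least 1 in
  every step, so \<open>w m \<le> 1 / m\<close> for positive \<open>m\<close>. The induction works
  with products because terms may vanish.\<close>

lemma tendsto_zero_if_step_le_div_one_plus: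
  fixes w :: "nat \<Rightarrow> real"
  assumes nn: "\<And>m. 0 \<le> w m" and step: "\<And>m. (1 + w m) * w (Suc m) \<le> w m"
  shows "w \<longlonglongrightarrow> 0"
proof -
  have "w (Suc m) * real (Suc m) \<le> 1" for m
  proof (induction m)
    case 0
    have "(1 + w 0) * w 1 \<le> (1 + w 0) * 1" using step[of 0] by simp
    moreover have "1 + w 0 > 0" using nn[of 0] by linarith
    ultimately have "w 1 \<le> 1" by (simp only: mult_le_cancel_left_pos)
    then show ?case by simp
  next
    case (Suc m)
    let ?u = "w (Suc m)" and ?n = "real (Suc m)"
    have "w (Suc (Suc m)) * ((1 + ?u) * (?n + 1)) \<le> ?u * (?n + 1)"
      using mult_right_mono[OF step[of "Suc m"], of "?n + 1"] by (simp add: algebra_simps)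
    \<comment> \<open>The induction hypothesis bounds \<open>?u * ?n\<close> by 1.\<close>
    also have "\<dots> \<le> 1 + ?u" using Suc by (simp add: algebra_simps)
    finally have "(1 + ?u) * (w (Suc (Suc m)) * (?n + 1)) \<le> (1 + ?u) * 1" by (simp add: algebra_simps)
    moreover have "1 + ?u > 0" using nn[of "Suc m"] by linarith
    ultimately have "w (Suc (Suc m)) * (?n + 1) \<le> 1" by (simp only: mult_le_cancel_left_pos)
    then show ?case by (simp add: algebra_simps)
  qed
  then have "w (Suc m) \<le> 1 / real (Suc m)" for m
    by (simp add: pos_le_divide_eq del: of_nat_Suc)
  then have "(\<lambda>m. w (Suc m)) \<longlonglongrightarrow> 0"
    using nn by (intro real_tendsto_sandwich[OF _ _ tendsto_const LIMSEQ_Suc[OF lim_1_over_n]]) auto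
  then show ?thesis by (simp only: filterlim_sequentially_Suc)
qed


subsection \<open>Parseval frames\<close>

context inner_product_space
begin

section \<open>Calculus of the inner product and its norm\<close>

lemma ip_zero_left [simp]: "ip 0 y = 0"
  using ip_scale_left[of 0 0 y] by simp

lemma ip_diff_left: "ip (x - y) z = ip x z - ip y z"
  using ip_add_left[of "x - y" y z] by simp

lemma ip_zero_right [simp]: "ip y 0 = 0"
  by (subst ip_conjugate) simp

lemma ip_add_right: "ip z (x + y) = ip z x + ip z y"
  by (metis conjugate_dist_add ip_add_left ip_conjugate)

lemma ip_scale_right: "ip z (c *s x) = conjugate c * ip z x"
  by (metis conjugate_dist_mul ip_scale_left ip_conjugate)

lemma ip_sum_left: "ip (\<Sum>i\<in>A. F i) y = (\<Sum>i\<in>A. ip (F i) y)"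
  by (induction A rule: infinite_finite_induct) (simp_all add: ip_add_left)

lemma ip_self: "ip x x = of_real ((vnorm x)\<^sup>2)"
  using ip_nonneg[of x] by (auto simp: vnorm_def elim!: nonneg_Reals_cases)

lemma vnorm_nonneg [simp]: "0 \<le> vnorm x"
  by (simp add: vnorm_def)

lemma vnorm_eq_0_iff [simp]: "vnorm x = 0 \<longleftrightarrow> x = 0"
  by (auto simp: vnorm_def dest: ip_eq_zeroD)

lemma vnorm_zero [simp]: "vnorm 0 = 0"
  by simp

lemma vnorm_scale_sq: "(vnorm (c *s x))\<^sup>2 = (norm c)\<^sup>2 * (vnorm x)\<^sup>2"
  by (simp add: vnorm_def ip_scale_left ip_scale_right norm_mult norm_conjugate power2_eq_square)

section \<open>The frame operator of a list\<close>

definition frame_op :: "'a list \<Rightarrow> 'a \<Rightarrow> 'a" where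
  "frame_op gs x = (\<Sum>g\<leftarrow>gs. ip x g *s g)"

lemma frame_op_simps [simp]:
  "frame_op [] x = 0"
  "frame_op (g # gs) x = ip x g *s g + frame_op gs x"
  "frame_op (gs @ gs') x = frame_op gs x + frame_op gs' x"
  by (simp_all add: frame_op_def)

lemma frame_op_nth: "frame_op gs x = (\<Sum>i<length gs. ip x (gs ! i) *s gs ! i)"
  by (simp add: frame_op_def sum_list_sum_nth atLeast0LessThan)

lemma frame_op_add: "frame_op gs (x + y) = frame_op gs x + frame_op gs y"
  by (induction gs) (simp_all add: ip_add_left algebra_simps)

lemma frame_op_scale: "frame_op gs (c *s x) = c *s frame_op gs x"
  by (induction gs) (simp_all add: ip_scale_left algebra_simps)

lemma frame_op_in_span: "frame_op gs x \<in> span (set gs)"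
proof (induction gs)
  case (Cons g gs)
  have "frame_op gs x \<in> span (set (g # gs))"
    using Cons span_mono[of "set gs" "set (g # gs)"] by auto
  moreover have "ip x g *s g \<in> span (set (g # gs))" by (rule span_scale[OF span_base]) simp
  ultimately show ?case unfolding frame_op_simps by (metis span_add)
qed (simp add: span_zero)

lemma frame_op_self_adjoint: "ip (frame_op gs x) y = ip x (frame_op gs y)"
proof (induction gs)
  case (Cons g gs)
  then show ?case
    by (simp add: ip_add_left ip_add_right ip_scale_left ip_scale_right ip_conjugate[of y g])
qed simp

lemma frame_op_orthogonal:
  assumes "\<And>g. g \<in> set gs \<Longrightarrow> ip x g = 0"
  shows "frame_op gs x = 0"
  using assms by (induction gs) simp_all

text \<open>A Parseval frame of its own span, encoded by the reconstruction formula; the usual norm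
  identity is derived in \<open>parseval_vnorm\<close>.\<close>

definition parseval :: "'a list \<Rightarrow> bool" where
  "parseval gs \<longleftrightarrow> (\<forall>x \<in> span (set gs). frame_op gs x = x)"

lemma parseval_ip:
  assumes "parseval gs" "x \<in> span (set gs)"
  shows "ip x y = (\<Sum>i<length gs. ip x (gs ! i) * ip (gs ! i) y)"
proof -
  have "ip x y = ip (frame_op gs x) y" using assms by (simp add: parseval_def)
  then show ?thesis by (simp add: frame_op_nth ip_sum_left ip_scale_left)
qed

lemma parseval_vnorm:
  assumes "parseval gs" "x \<in> span (set gs)"
  shows "(vnorm x)\<^sup>2 = (\<Sum>i<length gs. (norm (ip x (gs ! i)))\<^sup>2)"
proof -
  have "(of_real ((vnorm x)\<^sup>2) :: 'k) = (\<Sum>i<length gs. ip x (gs ! i) * ip (gs ! i) x)"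
    unfolding ip_self[symmetric] by (rule parseval_ip[OF assms])
  also have "\<dots> = (\<Sum>i<length gs. of_real ((norm (ip x (gs ! i)))\<^sup>2))"
    by (intro sum.cong refl) (metis ip_conjugate mult_conjugate_eq_norm)
  finally show ?thesis by (simp only: of_real_sum[symmetric] of_real_eq_iff)
qed

lemma parseval_norm_ip_le:
  assumes "parseval gs" "x \<in> span (set gs)" "i < length gs"
  shows "norm (ip x (gs ! i)) \<le> vnorm x"
proof -
  have "(norm (ip x (gs ! i)))\<^sup>2 \<le> (vnorm x)\<^sup>2"
    unfolding parseval_vnorm[OF assms(1,2)]
    by (rule member_le_sum) (use assms(3) in auto)
  then show ?thesis by (rule power2_le_imp_le) simp
qed

text \<open>Bounding the coefficient of a frame vector against itself gives
  \<open>(vnorm g)\<^sup>2 \<le> vnorm g\<close>.\<close>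

lemma parseval_vnorm_le_1:
  assumes "parseval gs" "i < length gs"
  shows "vnorm (gs ! i) \<le> 1"
proof -
  have "norm (ip (gs ! i) (gs ! i)) \<le> vnorm (gs ! i)"
    using assms by (intro parseval_norm_ip_le span_base) auto
  then have "vnorm (gs ! i) * vnorm (gs ! i) \<le> vnorm (gs ! i) * 1"
    by (simp add: ip_self power2_eq_square norm_mult)
  then show ?thesis
    by (cases "vnorm (gs ! i) = 0") (auto simp del: vnorm_eq_0_iff simp: mult_le_cancel_left less_le)
qed


subsection \<open>One round of the procedure\<close>

definition shrink_coeff :: "'a \<Rightarrow> real" where
  "shrink_coeff f = 1 / (vnorm f)\<^sup>2 * (1 / sqrt (1 + (vnorm f)\<^sup>2) - 1)"

text \<open>The operator \<open>T\<close> that the procedure applies to the earlier vectors when the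
  residual vanishes. For \<open>f = 0\<close> it is the identity.\<close>

definition shrink :: "'a \<Rightarrow> 'a \<Rightarrow> 'a" where
  "shrink f g = g + (of_real (shrink_coeff f) * ip g f) *s f"

lemma shrink_add: "shrink f (x + y) = shrink f x + shrink f y"
  by (simp add: shrink_def ip_add_left algebra_simps)

lemma shrink_scale: "shrink f (c *s x) = c *s shrink f x"
  by (simp add: shrink_def ip_scale_left algebra_simps)

lemma module_hom_shrink: "module_hom scale scale (shrink f)"
  by unfold_locales (simp_all add: shrink_add shrink_scale)

lemma shrink_zero [simp]: "shrink f 0 = 0"
  by (simp add: shrink_def)

lemma shrink_self_adjoint: "ip (shrink f x) y = ip x (shrink f y)"
  by (simp add: shrink_def ip_add_left ip_add_right ip_scale_left ip_scale_right conjugate_dist_mul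
      conjugate_of_real ip_conjugate[of y f])

text \<open>The left side is the eigenvalue of \<open>shrink f\<close> at \<open>f\<close>.\<close>

lemma shrink_coeff:
  assumes "f \<noteq> 0"
  shows "1 + shrink_coeff f * (vnorm f)\<^sup>2 = 1 / sqrt (1 + (vnorm f)\<^sup>2)"
  using assms by (simp add: shrink_coeff_def)

lemma shrink_self: "shrink f f = of_real (1 / sqrt (1 + (vnorm f)\<^sup>2)) *s f"
proof (cases "f = 0")
  case False
  have "shrink f f = of_real (1 + shrink_coeff f * (vnorm f)\<^sup>2) *s f"
    unfolding shrink_def ip_self of_real_add of_real_mult scale_left_distrib by simp
  then show ?thesis by (simp only: shrink_coeff[OF False])
qed simp

text \<open>With \<open>N = (vnorm f)\<^sup>2\<close>, the operator has eigenvalue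
  \<open>1 / sqrt (1 + N)\<close> at \<open>f\<close> and fixes every vector orthogonal to
  \<open>f\<close>. Its square thus has eigenvalue \<open>1 / (1 + N) = 1 - N / (1 + N)\<close> at
  \<open>f\<close>.\<close>

lemma shrink_shrink:
  "shrink f (shrink f x) = x - (of_real (1 / (1 + (vnorm f)\<^sup>2)) * ip x f) *s f"
proof (cases "f = 0")
  case True
  then show ?thesis by (simp add: shrink_def)
next
  case False
  define N where "N = (vnorm f)\<^sup>2"
  define a where "a = shrink_coeff f"
  have N: "N > 0" using False by (simp add: N_def)
  have aN: "(1 + a * N)\<^sup>2 = 1 / (1 + N)"
    using shrink_coeff[OF False] N by (simp add: N_def a_def power_divide)
  \<comment> \<open>The coefficient of \<open>f\<close> in the composite is found by multiplying
    with \<open>N\<close>, which completes a square.\<close>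
  have "(a + a * (1 + a * N)) * N = (1 + a * N)\<^sup>2 - 1"
    by (simp add: algebra_simps power2_eq_square)
  also have "\<dots> = - (1 / (1 + N)) * N"
    unfolding aN using N by (simp add: field_simps)
  finally have a: "a + a * (1 + a * N) = - (1 / (1 + N))" using N by (metis mult_right_cancel less_irrefl)
  have "shrink f (shrink f x) = shrink f x + (of_real a * ip x f) *s shrink f f"
    by (subst (2) shrink_def) (simp only: shrink_add shrink_scale a_def)
  also have "\<dots> = x + (of_real a * ip x f) *s f + (of_real a * ip x f) *s (of_real (1 + a * N) *s f)"
    by (simp only: shrink_def[of f x] shrink_self shrink_coeff[OF False, symmetric] a_def N_def)
  also have "\<dots> = x + (of_real (a + a * (1 + a * N)) * ip x f) *s f"
  proof -
    have "u *s f + u *s w *s f = (u + u * w) *s f" for u w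
      by (simp add: scale_left_distrib)
    moreover have "of_real (a + a * b) * p = of_real a * p + of_real a * p * of_real b" for b and p :: 'k
      by (simp add: algebra_simps)
    ultimately show ?thesis by (simp only: add.assoc)
  qed
  also have "\<dots> = x - (of_real (1 / (1 + N)) * ip x f) *s f"
    unfolding a by (simp only: of_real_minus mult_minus_left scale_minus_left diff_conv_add_uminus)
  finally show ?thesis by (simp only: N_def)
qed

text \<open>Self-adjointness turns the squared norm of \<open>T x\<close> into the inner product of
  \<open>T (T x)\<close> with \<open>x\<close>, which is the squared norm of \<open>x\<close> minus
  a nonnegative term.\<close>

lemma vnorm_shrink_le: "(vnorm (shrink f x))\<^sup>2 \<le> (vnorm x)\<^sup>2"
proof -
  have "(of_real ((vnorm (shrink f x))\<^sup>2) :: 'k) = ip (shrink f (shrink f x)) x"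
    by (metis ip_self shrink_self_adjoint)
  also have "\<dots> = of_real ((vnorm x)\<^sup>2) - of_real (1 / (1 + (vnorm f)\<^sup>2)) * (ip x f * conjugate (ip x f))"
    by (simp only: shrink_shrink ip_diff_left ip_scale_left ip_self ip_conjugate[of f x] mult.assoc)
  also have "\<dots> = of_real ((vnorm x)\<^sup>2 - 1 / (1 + (vnorm f)\<^sup>2) * (norm (ip x f))\<^sup>2)"
    by (simp only: mult_conjugate_eq_norm of_real_diff of_real_mult)
  finally have "(vnorm (shrink f x))\<^sup>2 = (vnorm x)\<^sup>2 - 1 / (1 + (vnorm f)\<^sup>2) * (norm (ip x f))\<^sup>2"
    by (simp only: of_real_eq_iff)
  then show ?thesis by simp
qed

lemma frame_op_map_shrink: "frame_op (map (shrink f) gs) x = shrink f (frame_op gs (shrink f x))"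
  by (induction gs) (simp_all add: shrink_add shrink_scale shrink_self_adjoint)


text \<open>The branch with nonzero residual. The frame operator is self-adjoint and fixes the old
  span, so \<open>h\<close> is orthogonal to that span; adjoining an orthogonal unit vector
  preserves reconstruction.\<close>

lemma parseval_snoc:
  fixes f gs
  defines "h \<equiv> f - frame_op gs f"
  defines "e \<equiv> of_real (1 / vnorm h) *s h"
  assumes gs: "parseval gs" and h: "h \<noteq> 0"
  shows "span (set (gs @ [e])) = span (insert f (set gs))" and "parseval (gs @ [e])"
proof -
  have h_orth: "ip h v = 0" if "v \<in> span (set gs)" for v
    using that gs by (simp add: h_def ip_diff_left frame_op_self_adjoint parseval_def)
  have e_orth: "ip e v = 0" "ip v e = 0" if "v \<in> span (set gs)" for v
    using h_orth[OF that] ip_conjugate[of v e] by (simp_all add: e_def ip_scale_left)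
  have "vnorm h \<noteq> 0" using h by simp
  then have h_eq: "h = of_real (vnorm h) *s e" by (simp add: e_def flip: of_real_mult)
  have "(vnorm e)\<^sup>2 = 1"
    unfolding e_def vnorm_scale_sq using \<open>vnorm h \<noteq> 0\<close>
    by (simp add: norm_divide power_divide)
  then have ee: "ip e e = 1" by (simp add: ip_self)
  have S: "span (set gs) \<subseteq> span (insert f (set gs))" "span (set gs) \<subseteq> span (insert e (set gs))"
    by (intro span_mono; blast)+
  have "h \<in> span (insert f (set gs))"
    unfolding h_def by (rule span_diff[OF span_base subsetD[OF S(1) frame_op_in_span]]) simp
  then have "e \<in> span (insert f (set gs))"
    unfolding e_def by (rule span_scale)
  moreover have "h + frame_op gs f \<in> span (insert e (set gs))"
    by (subst h_eq, rule span_add[OF span_scale[OF span_base] subsetD[OF S(2) frame_op_in_span]]) simp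
  then have "f \<in> span (insert e (set gs))" by (simp add: h_def)
  ultimately show "span (set (gs @ [e])) = span (insert f (set gs))"
    by (auto simp: span_eq intro: span_base)
  show "parseval (gs @ [e])"
    unfolding parseval_def
  proof
    fix x assume "x \<in> span (set (gs @ [e]))"
    \<comment> \<open>Split \<open>x\<close> along the old span and \<open>e\<close>; the old
      vectors reconstruct the first part and the new one the second.\<close>
    then obtain k where v: "x - k *s e \<in> span (set gs)" by (auto simp: span_breakdown_eq)
    define v where "v = x - k *s e"
    have x: "x = v + k *s e" by (simp add: v_def)
    have "frame_op gs v = v" using gs v by (simp add: parseval_def v_def)
    moreover have "frame_op gs e = 0" by (rule frame_op_orthogonal) (simp add: e_orth span_base)
    moreover have "ip x e = k" using e_orth(2)[OF v] by (simp add: x ip_add_left ip_scale_left ee flip: v_def)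
    ultimately show "frame_op (gs @ [e]) x = x"
      by (simp only: frame_op_simps) (simp add: x frame_op_add frame_op_scale)
  qed
qed

text \<open>The branch with zero residual. On the span the old frame operator is the identity, so
  the shrunken vectors have frame operator \<open>T\<close> squared there. The appended vector
  restores exactly the rank-one term that \<open>T\<close> squared subtracts.\<close>

lemma parseval_shrink_snoc:
  fixes f gs
  defines "gs' \<equiv> map (shrink f) gs @ [of_real (1 / sqrt (1 + (vnorm f)\<^sup>2)) *s f]"
  assumes gs: "parseval gs" and f: "f \<in> span (set gs)"
  shows "span (set gs') = span (set gs)" and "parseval gs'"
proof -
  have shrink_span: "shrink f x \<in> span (set gs)" if "x \<in> span (set gs)" for x
    unfolding shrink_def using that f by (intro span_add span_scale)
  have eq: "frame_op gs' x = x" if x: "x \<in> span (set gs)" for x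
  proof -
    define t where "t = 1 / sqrt (1 + (vnorm f)\<^sup>2)"
    have t: "t * t = 1 / (1 + (vnorm f)\<^sup>2)"
      by (simp add: t_def)
    have "frame_op gs (shrink f x) = shrink f x"
      using gs shrink_span[OF x] by (simp add: parseval_def)
    then have "frame_op gs' x = shrink f (shrink f x) + ip x (of_real t *s f) *s of_real t *s f"
      by (simp add: gs'_def frame_op_map_shrink t_def)
    also have "ip x (of_real t *s f) *s of_real t *s f = (of_real (t * t) * ip x f) *s f"
      by (simp add: ip_scale_right conjugate_of_real mult_ac)
    finally show ?thesis by (simp only: shrink_shrink t) simp
  qed
  have "set gs' \<subseteq> span (set gs)"
    using f by (auto simp: gs'_def intro!: shrink_span span_scale intro: span_base)
  moreover have "set gs \<subseteq> span (set gs')"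
    by (metis eq frame_op_in_span span_base subsetI)
  ultimately show "span (set gs') = span (set gs)" by (simp add: span_eq)
  then show "parseval gs'" using eq by (simp add: parseval_def)
qed

lemma shrink_in_span_image:
  "x \<in> span S \<Longrightarrow> shrink f x \<in> span (shrink f ` S)"
  using module_hom.span_image[OF module_hom_shrink] by blast

text \<open>The last clause treats the dependent indices, counted from 0: dependence on the
  preceding entries passes to the output, so it is available in the next round, and the norm bound
  is \<open>w / (1 + w)\<close> with the denominator cleared, as
  \<open>tendsto_zero_if_step_le_div_one_plus\<close> expects.\<close>

definition ggsp_invariant :: "'a list \<Rightarrow> 'a list \<Rightarrow> bool" where
  "ggsp_invariant fs gs \<longleftrightarrow>
     length gs = length fs \<and> span (set gs) = span (set fs) \<and> parseval gs \<and>
     (\<forall>k < length fs. fs ! k \<in> span (set (take k fs)) \<longrightarrow>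
        gs ! k \<in> span (set (take k gs)) \<and>
        (1 + (vnorm (fs ! k))\<^sup>2) * (vnorm (gs ! k))\<^sup>2 \<le> (vnorm (fs ! k))\<^sup>2)"

text \<open>A step leaves the earlier outputs alone or applies the linear contraction
  \<open>shrink f\<close> to all of them; linearity preserves dependence and contraction preserves
  the norm bounds.\<close>

lemma ggsp_invariant_step:
  assumes inv: "ggsp_invariant fs gs"
  shows "ggsp_invariant (fs @ [f]) (ggsp_step gs f)"
proof -
  have len: "length gs = length fs" and sp: "span (set gs) = span (set fs)" and par: "parseval gs"
    using inv by (auto simp: ggsp_invariant_def)
  have dep: "gs ! k \<in> span (set (take k gs))"
      "(1 + (vnorm (fs ! k))\<^sup>2) * (vnorm (gs ! k))\<^sup>2 \<le> (vnorm (fs ! k))\<^sup>2"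
      if "k < length fs" "fs ! k \<in> span (set (take k fs))" for k
    using inv that by (auto simp: ggsp_invariant_def)
  have insert_sp: "span (insert f (set gs)) = span (insert f (set fs))"
    using sp by (simp add: span_insert)
  define h where "h = f - frame_op gs f"
  consider (zero) "f = 0" | (indep) "f \<noteq> 0" "h \<noteq> 0" | (dependent) "f \<noteq> 0" "h = 0" by blast
  then show ?thesis
  proof cases
    case zero
    have "parseval (gs @ [0])" using par by (simp add: parseval_def)
    then show ?thesis using zero len sp dep
      by (auto simp: ggsp_invariant_def ggsp_step_def nth_append less_Suc_eq span_zero)
  next
    case indep
    have step: "ggsp_step gs f = gs @ [of_real (1 / vnorm h) *s h]"
      using indep by (simp add: ggsp_step_def h_def frame_op_def Let_def)
    \<comment> \<open>A nonzero residual means that the new index is not dependent, so the last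
      clause of the invariant demands nothing for it.\<close>
    have "f \<notin> span (set fs)"
      using indep(2) par by (auto simp: h_def parseval_def sp)
    moreover note parseval_snoc[OF par, of f, folded h_def, OF indep(2)]
    ultimately show ?thesis unfolding step using len dep insert_sp
      by (auto simp: ggsp_invariant_def nth_append less_Suc_eq)
  next
    case dependent
    define t where "t = 1 / sqrt (1 + (vnorm f)\<^sup>2)"
    have t: "t * t = 1 / (1 + (vnorm f)\<^sup>2)" "t > 0"
      by (simp_all add: t_def add_pos_nonneg)
    have step: "ggsp_step gs f = map (shrink f) gs @ [of_real t *s f]"
      using dependent by (simp add: ggsp_step_def h_def frame_op_def Let_def shrink_def shrink_coeff_def t_def)
    have f: "f \<in> span (set gs)"
      using dependent(2) frame_op_in_span[of gs f] by (simp add: h_def)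
    note new = parseval_shrink_snoc[OF par f, folded t_def]
    \<comment> \<open>Since \<open>f\<close> is an eigenvector with nonzero eigenvalue, it also lies
      in the span of the shrunken vectors, and hence so does the appended multiple of it.\<close>
    have "shrink f (of_real (1 / t) *s f) = f"
      using t(2) by (simp add: shrink_scale shrink_self t_def flip: of_real_mult)
    then have "f \<in> span (shrink f ` set gs)"
      using shrink_in_span_image[OF span_scale[OF f]] by metis
    then have f_last: "of_real t *s f \<in> span (shrink f ` set gs)" by (rule span_scale)
    have "1 + (vnorm f)\<^sup>2 > 0" by (simp add: add_pos_nonneg)
    \<comment> \<open>In fact an equality, as \<open>t * t\<close> cancels the factor on the
      left.\<close>
    then have norm_last: "(1 + (vnorm f)\<^sup>2) * (vnorm (of_real t *s f))\<^sup>2 \<le> (vnorm f)\<^sup>2"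
      by (simp add: vnorm_scale_sq power2_eq_square[of t] t(1))
    have "shrink f (gs ! k) \<in> span (shrink f ` set (take k gs)) \<and>
        (1 + (vnorm (fs ! k))\<^sup>2) * (vnorm (shrink f (gs ! k)))\<^sup>2 \<le> (vnorm (fs ! k))\<^sup>2"
      if k: "k < length fs" "fs ! k \<in> span (set (take k fs))" for k
    proof
      show "shrink f (gs ! k) \<in> span (shrink f ` set (take k gs))"
        by (rule shrink_in_span_image[OF dep(1)[OF k]])
      have "(1 + (vnorm (fs ! k))\<^sup>2) * (vnorm (shrink f (gs ! k)))\<^sup>2
          \<le> (1 + (vnorm (fs ! k))\<^sup>2) * (vnorm (gs ! k))\<^sup>2"
        by (intro mult_left_mono vnorm_shrink_le) simp
      with dep(2)[OF k] show "(1 + (vnorm (fs ! k))\<^sup>2) * (vnorm (shrink f (gs ! k)))\<^sup>2 \<le> (vnorm (fs ! k))\<^sup>2"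
        by linarith
    qed
    moreover have "span (set (fs @ [f])) = span (set gs)"
      using f sp by (simp add: span_redundant)
    ultimately show ?thesis
      unfolding step ggsp_invariant_def using len new f_last norm_last
      by (auto simp: nth_append less_Suc_eq take_map)
  qed
qed

lemma ggsp_invariant_ggsp: "ggsp_invariant fs (ggsp fs)"
proof (induction fs rule: rev_induct)
  case Nil
  show ?case by (simp add: ggsp_invariant_def ggsp_def parseval_def)
next
  case (snoc f fs)
  then show ?case using ggsp_invariant_step by (simp add: ggsp_def)
qed


subsection \<open>Limits of the iterates\<close>

text \<open>The dimension of the span is the number of positions at which the span of the prefix
  grows. This count is later compared with the number of nonzero limit vectors.\<close>

lemma exists_basis_card_new_directions:
  "\<exists>B. finite B \<and> independent B \<and> span B = span (set fs) \<and>
     card B = card {k. k < length fs \<and> fs ! k \<notin> span (set (take k fs))}"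
proof (induction fs rule: rev_induct)
  case Nil
  show ?case by (intro exI[of _ "{}"]) (simp add: independent_empty)
next
  case (snoc f fs)
  then obtain B where B: "finite B" "independent B" "span B = span (set fs)"
    "card B = card {k. k < length fs \<and> fs ! k \<notin> span (set (take k fs))}" by blast
  have new: "{k. k < length (fs @ [f]) \<and> (fs @ [f]) ! k \<notin> span (set (take k (fs @ [f])))} =
      {k. k < length fs \<and> fs ! k \<notin> span (set (take k fs))} \<union>
      (if f \<in> span (set fs) then {} else {length fs})"
    by (auto simp: nth_append less_Suc_eq)
  show ?case
  proof (cases "f \<in> span (set fs)")
    case True
    with B show ?thesis unfolding new by (intro exI[of _ B]) (simp add: span_redundant)
  next
    case False
    then have "f \<notin> B" using B(3) span_base by blast
    moreover have "span (insert f B) = span (insert f (set fs))" using B(3) by (simp add: span_insert)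
    moreover have "independent (insert f B)" using B False by (simp add: independent_insertI)
    ultimately show ?thesis using B False unfolding new by (intro exI[of _ "insert f B"]) simp
  qed
qed

text \<open>By the cardinality bound no nonzero entry lies in the span of the others. Reconstructing
  such an entry then forces its own coefficient to be 1, and the Parseval identity leaves 0 for all
  other coefficients.\<close>

lemma parseval_zero_extended_orthonormal_basis:
  assumes par: "parseval gs" and B: "independent B" "B \<subseteq> span (set gs)"
    and card: "card {i. i < length gs \<and> gs ! i \<noteq> 0} \<le> card B"
  shows "zero_extended_orthonormal_basis gs (span (set gs))"
proof -
  \<comment> \<open>Indices are counted instead of vectors, because a list may a priori repeat an
    entry.\<close>
  define J where "J = {i. i < length gs \<and> gs ! i \<noteq> 0}"
  have J: "finite J" by (simp add: J_def)
  have new: "gs ! i \<notin> span ((!) gs ` (J - {i}))" if i: "i \<in> J" for i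
  proof
    assume red: "gs ! i \<in> span ((!) gs ` (J - {i}))"
    have "gs ! k \<in> span ((!) gs ` (J - {i}))" if "k < length gs" for k
      using that red by (cases "k = i"; cases "gs ! k = 0") (auto simp: J_def span_zero intro!: span_base)
    then have "set gs \<subseteq> span ((!) gs ` (J - {i}))" by (auto simp: in_set_conv_nth)
    then have "B \<subseteq> span ((!) gs ` (J - {i}))"
      using B(2) span_minimal subspace_span by blast
    then have "card B \<le> card ((!) gs ` (J - {i}))"
      using independent_span_bound[OF finite_imageI[OF finite_Diff[OF J]] B(1)] by simp
    also have "\<dots> \<le> card (J - {i})" using J by (intro card_image_le) simp
    also have "\<dots> < card J" using J i by (intro card_Diff1_less)
    finally show False using card by (simp add: J_def)
  qed
  have diag: "ip (gs ! i) (gs ! i) = 1" if i: "i \<in> J" for i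
  proof (rule ccontr)
    assume ne: "ip (gs ! i) (gs ! i) \<noteq> 1"
    let ?g = "gs ! i"
    have "?g = frame_op gs ?g"
      using par i by (simp add: parseval_def J_def span_base)
    also have "\<dots> = (\<Sum>k\<in>J. ip ?g (gs ! k) *s gs ! k)"
      unfolding frame_op_nth by (rule sum.mono_neutral_right) (auto simp: J_def)
    also have "\<dots> = ip ?g ?g *s ?g + (\<Sum>k\<in>J - {i}. ip ?g (gs ! k) *s gs ! k)"
      using J i by (rule sum.remove)
    \<comment> \<open>Were the factor on the left nonzero, dividing by it would express
      \<open>?g\<close> through the other entries.\<close>
    finally have "(1 - ip ?g ?g) *s ?g = (\<Sum>k\<in>J - {i}. ip ?g (gs ! k) *s gs ! k)"
      by (simp add: scale_left_diff_distrib diff_eq_eq add.commute)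
    also have "\<dots> \<in> span ((!) gs ` (J - {i}))"
      by (intro span_sum span_scale span_base imageI)
    finally have "inverse (1 - ip ?g ?g) *s (1 - ip ?g ?g) *s ?g \<in> span ((!) gs ` (J - {i}))"
      by (rule span_scale)
    then show False using ne new[OF i] by simp
  qed
  have off: "ip (gs ! i) (gs ! k) = 0" if k: "i < length gs" "k < length gs" "i \<noteq> k" for i k
  proof (cases "i \<in> J")
    case False
    then show ?thesis using k by (simp add: J_def)
  next
    case True
    let ?a = "\<lambda>k. (norm (ip (gs ! i) (gs ! k)))\<^sup>2"
    have "(vnorm (gs ! i))\<^sup>2 = 1"
      using diag[OF True] unfolding ip_self by (metis of_real_eq_1_iff)
    moreover have "(vnorm (gs ! i))\<^sup>2 = (\<Sum>k<length gs. ?a k)"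
      using par k by (intro parseval_vnorm span_base) auto
    moreover have "\<dots> = ?a i + (\<Sum>k\<in>{..<length gs} - {i}. ?a k)"
      using k by (intro sum.remove) auto
    ultimately have "(\<Sum>k\<in>{..<length gs} - {i}. ?a k) = 0"
      using diag[OF True] by simp
    then show ?thesis using k by (subst (asm) sum_nonneg_eq_0_iff) auto
  qed
  define es where "es = filter (\<lambda>g. g \<noteq> 0) gs"
  \<comment> \<open>Filtering shifts the indices but preserves \<open>sorted_wrt\<close>, so
    pairwise orthogonality survives; conjugation supplies the reversed pairs.\<close>
  have "sorted_wrt (\<lambda>x y. ip x y = 0) gs"
    using off by (simp add: sorted_wrt_iff_nth_less)
  then have "sorted_wrt (\<lambda>x y. ip x y = 0) es"
    unfolding es_def by (rule sorted_wrt_filter)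
  then have lt: "ip (es ! i) (es ! k) = 0" if "i < k" "k < length es" for i k
    using that by (simp add: sorted_wrt_iff_nth_less)
  have gt: "ip (es ! k) (es ! i) = 0" if "i < k" "k < length es" for i k
    using lt[OF that] ip_conjugate[of "es ! k" "es ! i"] by simp
  have eq: "ip (es ! i) (es ! i) = 1" if "i < length es" for i
  proof -
    have "es ! i \<in> set es" using that by simp
    then obtain k where "k < length gs" "gs ! k = es ! i" "gs ! k \<noteq> 0"
      by (auto simp: es_def in_set_conv_nth)
    then show ?thesis using diag[of k] by (simp add: J_def)
  qed
  have "set es = set gs - {0}" by (auto simp: es_def)
  then have "span (set es) = span (set gs)" by simp
  moreover have "ip (es ! i) (es ! k) = (if i = k then 1 else 0)" if "i < length es" "k < length es" for i k
    using lt[of i k] gt[of k i] eq that by (cases i k rule: linorder_cases) auto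
  ultimately show ?thesis
    by (simp add: zero_extended_orthonormal_basis_def orthonormal_basis_def flip: es_def)
qed

section \<open>Subsequential limits of the iterated procedure\<close>

theorem ggsp_iterates_subsequence:
  fixes G :: "nat \<Rightarrow> 'a list"
  assumes G0: "G 0 = fs" and GSuc: "\<And>m. G (Suc m) = ggsp (G m)"
  shows "\<exists>r gs. strict_mono (r :: nat \<Rightarrow> nat) \<and> length gs = length fs \<and> l2_converges (G \<circ> r) gs \<and>
    zero_extended_orthonormal_basis gs (span (set fs)) \<and>
    (\<forall>k < length fs. gs ! k = 0 \<longleftrightarrow> fs ! k \<in> span (set (take k fs)))"
proof -
  define n where "n = length fs"
  define V where "V = span (set fs)"
  define D where "D = {k. k < n \<and> fs ! k \<in> span (set (take k fs))}"
  have inv: "ggsp_invariant (G m) (G (Suc m))" for m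
    using GSuc ggsp_invariant_ggsp by simp
  have len: "length (G m) = n" for m
    by (induction m) (use inv in \<open>auto simp: ggsp_invariant_def G0 n_def\<close>)
  have sp: "span (set (G m)) = V" for m
    by (induction m) (use inv in \<open>auto simp: ggsp_invariant_def G0 V_def\<close>)
  have par: "parseval (G (Suc m))" for m
    using inv by (simp add: ggsp_invariant_def)
  \<comment> \<open>An index dependent in the input stays dependent in every round, so the norm
    bound applies to it each time.\<close>
  have dep: "G m ! k \<in> span (set (take k (G m)))" if "k \<in> D" for k m
    by (induction m) (use that inv len in \<open>auto simp: ggsp_invariant_def G0 D_def\<close>)
  have "(1 + (vnorm (G m ! k))\<^sup>2) * (vnorm (G (Suc m) ! k))\<^sup>2 \<le> (vnorm (G m ! k))\<^sup>2"
    if "k \<in> D" for k m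
    using dep[OF that, of m] inv[of m] len[of m] that by (auto simp: ggsp_invariant_def D_def)
  then have "(\<lambda>m. (vnorm (G m ! k))\<^sup>2) \<longlonglongrightarrow> 0" if "k \<in> D" for k
    using that by (intro tendsto_zero_if_step_le_div_one_plus) simp_all
  then have decay: "(\<lambda>m. vnorm (G m ! k)) \<longlonglongrightarrow> 0" if "k \<in> D" for k
    using that tendsto_real_sqrt[of "\<lambda>m. (vnorm (G m ! k))\<^sup>2" 0 sequentially] by simp

  \<comment> \<open>The input need not be a Parseval frame, but the first output is one; it provides
    fixed coordinates on \<open>V\<close> for all iterates.\<close>
  define E where "E = G 1"
  have E: "parseval E" "length E = n" "span (set E) = V"
    using par[of 0] len[of 1] sp[of 1] by (simp_all add: E_def)
  have G_V: "G m ! i \<in> V" if "i < n" for i m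
    using sp[of m] that len[of m] span_base by (metis nth_mem)
  have coord_le: "norm (ip (G m ! i) (E ! j)) \<le> vnorm (G m ! i)" if "i < n" "j < n" for i j m
    using parseval_norm_ip_le[OF E(1)] E G_V that by simp
  have "norm (ip (G (Suc m) ! i) (E ! j)) \<le> 1" if "i < n" "j < n" for i j m
    using coord_le[OF that, of "Suc m"] parseval_vnorm_le_1[OF par, of i m] that len[of "Suc m"] by simp
  then obtain r c where r: "strict_mono (r :: nat \<Rightarrow> nat)"
    and c: "\<forall>p \<in> {..<n} \<times> {..<n}.
      ((\<lambda>m. ip (G (Suc m) ! fst p) (E ! snd p)) \<circ> r) \<longlonglongrightarrow> c p"
    using real_or_complex_convergent_subsequence_finite[of "{..<n} \<times> {..<n}"
        "\<lambda>p m. ip (G (Suc m) ! fst p) (E ! snd p)" 1] by auto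
  \<comment> \<open>The limit is assembled from the limits of the coordinates by the reconstruction
    formula of \<open>E\<close>.\<close>
  define gs where "gs = map (\<lambda>i. \<Sum>j<n. c (i, j) *s E ! j) [0..<n]"
  have gs_len: "length gs = n" by (simp add: gs_def)
  have gs_V: "gs ! i \<in> V" if "i < n" for i
    using that E(2) span_sum[of "{..<n}" "\<lambda>j. c (i, j) *s E ! j" "set E"]
    by (simp add: gs_def span_scale span_base flip: E(3))
  define X where "X m = G (Suc (r m))" for m
  have X: "parseval (X m)" "length (X m) = n" "span (set (X m)) = V" for m
    using par len sp by (simp_all add: X_def)
  have X_V: "X m ! i \<in> V" if "i < n" for i m
    using G_V that by (simp add: X_def)
  have ip_lim: "(\<lambda>m. ip (X m ! i) y) \<longlonglongrightarrow> ip (gs ! i) y" if i: "i < n" for i y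
  proof -
    have "(\<lambda>m. \<Sum>j<n. ip (X m ! i) (E ! j) * ip (E ! j) y) \<longlonglongrightarrow> (\<Sum>j<n. c (i, j) * ip (E ! j) y)"
      using c i by (intro tendsto_intros) (auto simp: X_def o_def)
    moreover have "ip (X m ! i) y = (\<Sum>j<n. ip (X m ! i) (E ! j) * ip (E ! j) y)" for m
      using parseval_ip[OF E(1)] E X_V[OF i] by simp
    moreover have "ip (gs ! i) y = (\<Sum>j<n. c (i, j) * ip (E ! j) y)"
      using i by (simp add: gs_def ip_sum_left ip_scale_left)
    ultimately show ?thesis by simp
  qed
  have "(\<lambda>m. (vnorm (X m ! i - gs ! i))\<^sup>2) \<longlonglongrightarrow> 0" if i: "i < n" for i
  proof -
    \<comment> \<open>The Parseval identity for \<open>E\<close> reduces norm convergence to the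
      finitely many coordinates.\<close>
    have "(vnorm (X m ! i - gs ! i))\<^sup>2 = (\<Sum>j<n. (norm (ip (X m ! i) (E ! j) - ip (gs ! i) (E ! j)))\<^sup>2)" for m
    proof -
      have "X m ! i - gs ! i \<in> span (set E)"
        unfolding E(3) using X_V[OF i] gs_V[OF i] unfolding V_def by (rule span_diff)
      from parseval_vnorm[OF E(1) this] show ?thesis by (simp add: E ip_diff_left)
    qed
    moreover have "(\<lambda>m. \<Sum>j<n. (norm (ip (X m ! i) (E ! j) - ip (gs ! i) (E ! j)))\<^sup>2) \<longlonglongrightarrow> (\<Sum>j<n. 0)"
      by (intro tendsto_sum tendsto_null_power tendsto_norm_zero LIM_zero ip_lim[OF i]) simp
    ultimately show ?thesis by simp
  qed
  then have "(\<lambda>m. sqrt (\<Sum>i<n. (vnorm (X m ! i - gs ! i))\<^sup>2)) \<longlonglongrightarrow> sqrt (\<Sum>i<n. 0)"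
    by (intro tendsto_real_sqrt tendsto_sum) simp
  moreover have "l2norm (map2 (-) (X m) gs) = sqrt (\<Sum>i<n. (vnorm (X m ! i - gs ! i))\<^sup>2)" for m
    by (simp add: l2norm_def sum_list_sum_nth atLeast0LessThan X gs_len)
  ultimately have conv: "l2_converges X gs"
    by (simp add: l2_converges_def X gs_len)

  have gs_frame: "frame_op gs x = x" if x: "x \<in> V" for x
  proof -
    \<comment> \<open>Tested against \<open>y\<close>, reconstruction by \<open>X m\<close> gives
      the same value for every \<open>m\<close>, and the limit of that constant sequence is the
      expression for \<open>gs\<close>.\<close>
    have "ip (frame_op gs x) y = ip x y" for y
    proof -
      have "(\<lambda>m. \<Sum>i<n. conjugate (ip (X m ! i) x) * ip (X m ! i) y)
          \<longlonglongrightarrow> (\<Sum>i<n. conjugate (ip (gs ! i) x) * ip (gs ! i) y)"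
        by (intro tendsto_sum tendsto_mult conjugate_tendsto ip_lim) simp_all
      moreover have "(\<Sum>i<n. conjugate (ip (X m ! i) x) * ip (X m ! i) y) = ip x y" for m
        using parseval_ip[OF X(1), of x m y] X(2,3)[of m] x by (simp add: ip_conjugate[of x, symmetric])
      moreover have "(\<Sum>i<n. conjugate (ip (gs ! i) x) * ip (gs ! i) y) = ip (frame_op gs x) y"
        by (simp add: frame_op_nth gs_len ip_sum_left ip_scale_left ip_conjugate[of x, symmetric])
      ultimately show ?thesis by (simp add: LIMSEQ_const_iff)
    qed
    then have "ip (frame_op gs x - x) (frame_op gs x - x) = 0" by (simp add: ip_diff_left)
    then show ?thesis by (metis ip_eq_zeroD right_minus_eq)
  qed
  have gs_sp: "span (set gs) = V"
  proof
    show "span (set gs) \<subseteq> V"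
      unfolding V_def using gs_V gs_len
      by (intro span_minimal subspace_span) (auto simp: in_set_conv_nth V_def)
    show "V \<subseteq> span (set gs)" by (metis gs_frame frame_op_in_span subsetI)
  qed
  have gs_par: "parseval gs" using gs_frame by (simp add: parseval_def gs_sp)

  have gs_D: "gs ! k = 0" if k: "k \<in> D" for k
  proof -
    have kn: "k < n" using k by (simp add: D_def)
    \<comment> \<open>The coordinates are dominated by norms that tend to 0, and a vector of
      \<open>V\<close> with zero coordinates vanishes.\<close>
    have "ip (gs ! k) (E ! j) = 0" if j: "j < n" for j
    proof -
      have "(\<lambda>m. vnorm (X m ! k)) \<longlonglongrightarrow> 0"
        using LIMSEQ_subseq_LIMSEQ[OF LIMSEQ_Suc[OF decay[OF k]] r] by (simp add: o_def X_def)
      then have "(\<lambda>m. ip (X m ! k) (E ! j)) \<longlonglongrightarrow> 0"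
        by (rule Lim_null_comparison[rotated]) (use coord_le[OF kn j] in \<open>simp add: X_def\<close>)
      then show ?thesis using ip_lim[OF kn] LIMSEQ_unique by blast
    qed
    then have "frame_op E (gs ! k) = 0"
      by (intro frame_op_orthogonal) (auto simp: in_set_conv_nth E(2))
    then show ?thesis using E gs_V[OF kn] by (simp add: parseval_def)
  qed
  define J where "J = {i. i < n \<and> gs ! i \<noteq> 0}"
  obtain B where B: "finite B" "independent B" "span B = V"
    "card B = card {k. k < n \<and> fs ! k \<notin> span (set (take k fs))}" (is "_ = card ?I")
    using exists_basis_card_new_directions[of fs] by (auto simp: n_def V_def)
  have J_sub: "J \<subseteq> ?I" using gs_D by (auto simp: J_def D_def)
  then have "card J \<le> card B" using B(4) by (simp add: card_mono)
  then have basis: "zero_extended_orthonormal_basis gs V"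
    using parseval_zero_extended_orthonormal_basis[OF gs_par B(2)] span_superset[of B] B(3) gs_sp
    by (simp add: J_def gs_len)
  \<comment> \<open>The converse count: the nonzero limit vectors span \<open>V\<close>, so there
    are at least \<open>dim V\<close> of them. Together with \<open>J_sub\<close> this makes
    \<open>J\<close> equal to the set of independent positions.\<close>
  have "span ((!) gs ` J) = V"
  proof -
    have "set gs - {0} = (!) gs ` J" by (auto simp: J_def gs_len in_set_conv_nth image_iff)
    then show ?thesis using span_delete_0[of "set gs"] gs_sp by simp
  qed
  then have "card B \<le> card ((!) gs ` J)"
    using independent_span_bound[of "(!) gs ` J" B] B span_superset[of B] by (simp add: J_def)
  also have "\<dots> \<le> card J" by (intro card_image_le) (simp add: J_def)
  finally have "J = ?I" using J_sub B(4) by (intro card_seteq) auto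
  then have "\<forall>k < n. gs ! k = 0 \<longleftrightarrow> fs ! k \<in> span (set (take k fs))"
    by (auto simp: J_def set_eq_iff)
  \<comment> \<open>The shift by one skips \<open>G 0\<close>, which \<open>X\<close> never
    uses.\<close>
  moreover have "strict_mono (Suc \<circ> r)" using r by (simp add: strict_mono_def)
  moreover have "G \<circ> (Suc \<circ> r) = X" by (simp add: X_def fun_eq_iff)
  ultimately show ?thesis using conv basis gs_len unfolding n_def V_def by metis
qed

end

theorem theorem2p4:
  fixes scale :: "'k::real_or_complex \<Rightarrow> 'a::ab_group_add \<Rightarrow> 'a"
    and ip :: "'a \<Rightarrow> 'a \<Rightarrow> 'k"
    and fs :: "'a list"
    and G :: "nat \<Rightarrow> 'a list"
  assumes "finite_dimensional_hilbert_space scale ip"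
    and "G 0 = fs"
    and "\<And>m. G (Suc m) = inner_product_space.ggsp scale ip (G m)"
  shows "\<exists>r gs. strict_mono (r :: nat \<Rightarrow> nat)
    \<and> length gs = length fs
    \<and> inner_product_space.l2_converges ip (G \<circ> r) gs
    \<and> inner_product_space.zero_extended_orthonormal_basis scale ip gs (module.span scale (set fs))
    \<and> (\<forall>k < length fs. gs ! k = 0 \<longleftrightarrow> fs ! k \<in> module.span scale (set (take k fs)))"
proof -
  interpret finite_dimensional_hilbert_space scale ip by fact
  show ?thesis using assms(2,3) by (rule ggsp_iterates_subsequence)
qed

end
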